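(* Let $x\in\mathbb R$ with $x>0$ and let $y\in\mathbb R$. Then the limiting probability, as $n\to\infty$, that in a uniformly random assignment of $n+\lfloor y\sqrt n\rfloor$ drivers to $n$ spaces at least $\lfloor x\sqrt n\rfloor$ drivers fail to park is $$\lim_{n\to\infty}\frac{S\big(n,\,n+\lfloor y\sqrt n\rfloor,\,\lfloor x\sqrt n\rfloor\big)}{n^{\,n+\lfloor y\sqrt n\rfloor}}=\begin{cases} e^{-2x(x-y)} & \text{if } x>y,\\ 1 & \text{otherwise.}\end{cases}$$
   Context: Car parking problem: a car park has $n$ spaces in a line, numbered $1,\dots,n$, and $m$ drivers arrive one after the other. Each driver has chosen a preferred space, so an assignment is a function $f:\{1,\dots,m\}\to\{1,\dots,n\}$, and there are $n^m$ assignments; a random assignment is one chosen uniformly among these. Each arriving driver parks in the chosen space if it is free; otherwise the driver takes the first free space with a larger number, if there is one; if there is none, the driver fails to park and goes home. For $n,m,k\in\mathbb N_0$ define $$S(n,m,k)=\begin{cases} n^m & \text{if } k\le m-n,\\ \displaystyle\sum_{i=0}^{m-k}\binom{m}{i}\,(n-m+k)\,(n-m+k+i)^{i-1}\,(m-k-i)^{m-i} & \text{otherwise.}\end{cases}$$ Here $0^0=1$, and an empty sum (when $k>m$) is $0$. The number $S(n,m,k)$ is the number of assignments of $m$ drivers to $n$ spaces for which at least $k$ drivers fail to park. If $y<0$, only those $n$ with $n+\lfloor y\sqrt n\rfloor\ge 0$ (all sufficiently large $n$) are considered. *)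

theory Defs
  imports "HOL-Probability.Probability"
begin

definition assignments :: "nat \<Rightarrow> nat \<Rightarrow> (nat \<Rightarrow> nat) set" where
  "assignments n m = {1..m} \<rightarrow>\<^sub>E {1..n}"

text \<open>The space taken by a driver with preferred space \<open>s\<close> who arrives when exactly the spaces in
  \<open>Q\<close> are occupied; \<open>None\<close> means that the driver fails to park.\<close>

definition park_at :: "nat \<Rightarrow> nat set \<Rightarrow> nat \<Rightarrow> nat option" where
  "park_at n Q s =
     (if s \<notin> Q then Some s
      else if \<exists>t\<in>{s<..n}. t \<notin> Q then Some (LEAST t. t \<in> {s<..n} \<and> t \<notin> Q)
      else None)"

text \<open>The set of spaces occupied after drivers \<open>1, \<dots>, j\<close> have arrived, in this order.\<close>

fun occupied :: "nat \<Rightarrow> (nat \<Rightarrow> nat) \<Rightarrow> nat \<Rightarrow> nat set" where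
  "occupied n f 0 = {}"
| "occupied n f (Suc j) =
     (case park_at n (occupied n f j) (f (Suc j)) of
        None \<Rightarrow> occupied n f j
      | Some t \<Rightarrow> insert t (occupied n f j))"

definition failures :: "nat \<Rightarrow> nat \<Rightarrow> (nat \<Rightarrow> nat) \<Rightarrow> nat" where
  "failures n m f = card {j \<in> {1..m}. park_at n (occupied n f (j - 1)) (f j) = None}"

text \<open>If \<open>n = 0\<close> and \<open>m > 0\<close>, there are no assignments and the value is unspecified.\<close>

definition fail_prob :: "nat \<Rightarrow> nat \<Rightarrow> nat \<Rightarrow> real" where
  "fail_prob n m k = measure_pmf.prob (pmf_of_set (assignments n m)) {f. k \<le> failures n m f}"

text \<open>The index set \<open>{i. i + k \<le> m}\<close> is \<open>{0..m - k}\<close> for \<open>k \<le> m\<close> and empty for \<open>k > m\<close>.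
  In the second branch \<open>n - m + k \<ge> 1\<close>, so the base of the power with exponent \<open>i - 1\<close>
  (which is \<open>-1\<close> for \<open>i = 0\<close>) is positive.\<close>

definition S :: "nat \<Rightarrow> nat \<Rightarrow> nat \<Rightarrow> real" where
  "S n m k =
     (if int k \<le> int m - int n then real n ^ m
      else (\<Sum>i | i + k \<le> m.
        real (m choose i) * (real n - real m + real k)
        * (real n - real m + real k + real i) powi (int i - 1)
        * (real m - real k - real i) ^ (m - i)))"

text \<open>The truncation by \<open>nat\<close> only has an effect if \<open>y < 0\<close>, and then only for finitely many \<open>n\<close>.\<close>

definition num_drivers :: "real \<Rightarrow> nat \<Rightarrow> nat" where
  "num_drivers y n = nat (int n + \<lfloor>y * sqrt (real n)\<rfloor>)"

end

theory Submission
  imports Defs "HOL-Real_Asymp.Real_Asymp"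
begin

text \<open>
  \<^bold>\<open>Counting.\<close> Let \<open>N t\<close> be the number of drivers who prefer a space in \<open>{1..t}\<close>. Looking at the last
  space that stays free shows that at least \<open>k\<close> drivers fail to park exactly if \<open>N t + d \<le> t\<close> for some
  \<open>t \<le> n\<close>, where \<open>d = n + k - m\<close> (\<open>le_failures_iff\<close>). Since \<open>N t - t\<close> starts at \<open>0\<close> and decreases by at
  most \<open>1\<close> per step, for \<open>d > 0\<close> it takes the value \<open>- d\<close> at the first such time \<open>t\<close>, so \<open>t = d + i\<close>
  where \<open>i\<close> drivers prefer \<open>{1..t}\<close>. Splitting by the set of these drivers yields the sum \<open>S\<close>, once the
  \<open>i\<close> early drivers are known to have \<open>d (d + i)^(i - 1)\<close> choices (\<open>card_first_hits\<close>). That number follows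
  by induction from the same splitting applied to \<open>n = d + i\<close>, where a hit is certain, and
  Abel's binomial identity (\<open>abel_identity\<close>).

  \<^bold>\<open>Limit.\<close> Abel's identity acts as a reflection principle. Put
  \<open>D = n - d\<close>, so that \<open>m = D + k\<close>. For \<open>D\<close> instead of \<open>D + k\<close> drivers the first hit is certain, which
  gives weights \<open>w i\<close> with sum \<open>1\<close>, of which only those with \<open>i < D\<close> matter below.
  Relative to these, with \<open>M = D - i\<close>,
  \<^item> the sum \<open>S n (D + k) k / n^(D + k)\<close> is \<open>(\<Prod>j=1..k. (D + j) / n) * (\<Sum>i. w i * A i)\<close> with
    \<open>A i = (\<Prod>j=1..k. 1 / (1 + j / M))\<close> (\<open>S_eq_rising_sum\<close>);
  \<^item> Abel's identity for \<open>D - k\<close> drivers says \<open>(\<Prod>j<k. (D - j) / n) = (\<Sum>i. w i * B i)\<close>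
    with \<open>B i = (\<Prod>j<k. 1 - j / M)\<close> for \<open>k \<le> M\<close> and \<open>B i = 0\<close> otherwise (\<open>falling_prod_eq_sum\<close>).

  Both \<open>A i\<close> and \<open>B i\<close> are close to \<open>exp (- k\<^sup>2 / (2 M))\<close>, and they differ by \<open>O(1 / sqrt k)\<close> uniformly
  in \<open>M\<close> (\<open>abs_rising_minus_falling_ratio_le\<close>). Hence \<open>S / n^m\<close> is asymptotically the product of the two
  elementary products, which is close to \<open>(D / n)^(2 k) = (1 - d / n)^(2 k)\<close>. With \<open>k\<close> near \<open>x sqrt n\<close> and
  \<open>d\<close> near \<open>(x - y) sqrt n\<close> this tends to \<open>exp (- 2 x (x - y))\<close>. If \<open>x \<le> y\<close>, then \<open>k \<le> m - n\<close> and the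
  probability is \<open>1\<close>.
\<close>

section \<open>Abel's binomial identity\<close>

text \<open>An \<open>n\<close>-th finite difference kills polynomials of degree less than \<open>n\<close>. Split off one
  factor \<open>x + i\<close>: the part with \<open>x\<close> has a smaller exponent, and in the part with \<open>i\<close> the factor \<open>i\<close> is absorbed
  into the binomial coefficient, which lowers \<open>n\<close> together with the exponent.\<close>

lemma alternating_binomial_power_sum_eq_0:
  fixes x :: real
  shows "p < n \<Longrightarrow> (\<Sum>i\<le>n. (-1) ^ i * real (n choose i) * (x + real i) ^ p) = 0"
proof (induction p arbitrary: n x)
  case 0
  then show ?case
    using choose_alternating_sum[of n, where ?'a = real] by simp
next
  case (Suc p)
  then obtain m where n: "n = Suc m" and "p < m"
    by (cases n) auto
  have "(\<Sum>i\<le>Suc m. (-1) ^ i * real (Suc m choose i) * (real i * (x + real i) ^ p))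
      = (\<Sum>i\<le>m. (-1) ^ Suc i * (real (Suc m choose Suc i) * real (Suc i)) * (x + real (Suc i)) ^ p)"
    by (subst sum.atMost_Suc_shift) (simp add: mult_ac)
  also have "\<dots> = (\<Sum>i\<le>m. - real (Suc m) * ((-1) ^ i * real (m choose i) * (x + 1 + real i) ^ p))"
  proof (intro sum.cong refl)
    fix i
    have "real (Suc m choose Suc i) * real (Suc i) = real (Suc m) * real (m choose i)"
      using Suc_times_binomial_eq[of m i] by (metis of_nat_mult)
    then show "(-1) ^ Suc i * (real (Suc m choose Suc i) * real (Suc i)) * (x + real (Suc i)) ^ p
        = - real (Suc m) * ((-1) ^ i * real (m choose i) * (x + 1 + real i) ^ p)"
      by (simp only:) (simp add: algebra_simps)
  qed
  also have "\<dots> = 0"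
    using Suc.IH[OF \<open>p < m\<close>, of "x + 1"] by (simp only: sum_distrib_left[symmetric] mult_zero_right)
  finally have shifted: "(\<Sum>i\<le>n. (-1) ^ i * real (n choose i) * (real i * (x + real i) ^ p)) = 0"
    by (simp only: n)
  have "(\<Sum>i\<le>n. (-1) ^ i * real (n choose i) * (x + real i) ^ Suc p)
      = x * (\<Sum>i\<le>n. (-1) ^ i * real (n choose i) * (x + real i) ^ p)
        + (\<Sum>i\<le>n. (-1) ^ i * real (n choose i) * (real i * (x + real i) ^ p))"
    by (simp add: sum_distrib_left sum.distrib[symmetric] algebra_simps)
  then show ?case
    using shifted Suc.IH[of n x] \<open>p < m\<close> n by simp
qed

text \<open>For \<open>x = d > 0\<close>, the number of ways in which \<open>i\<close> drivers can be assigned to \<open>d + i\<close> spaces so that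
  \<open>d + i\<close> is the first time at which their counting walk is \<open>d\<close> behind (see \<open>card_first_hits\<close>). The
  exponent is \<open>-1\<close> for \<open>i = 0\<close>, where the value is \<open>1\<close>.\<close>

definition abel_coeff :: "real \<Rightarrow> nat \<Rightarrow> real" where
  "abel_coeff x i = x * (x + real i) powi (int i - 1)"

lemma abel_coeff_eq:
  assumes "x > 0"
  shows "abel_coeff x i = x * (x + real i) ^ i / (x + real i)"
  using assms unfolding abel_coeff_def by (simp add: power_int_diff add_pos_nonneg)

text \<open>Both sides are polynomials in \<open>y\<close>, and their derivatives agree by the induction hypothesis. At
  \<open>y = - x\<close> the right-hand side vanishes, and each power \<open>(y - i)^(n - i)\<close> merges with
  \<open>(x + i)^(i - 1)\<close>, which leaves an \<open>n\<close>-th difference of a polynomial of degree \<open>n - 1\<close>.\<close>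

lemma abel_identity:
  fixes x y :: real
  assumes "x > 0"
  shows "(\<Sum>i\<le>n. real (n choose i) * abel_coeff x i * (y - real i) ^ (n - i)) = (x + y) ^ n"
proof (induction n arbitrary: y)
  case 0
  then show ?case
    using assms by (simp add: abel_coeff_eq)
next
  case (Suc n)
  define g where
    "g = (\<lambda>y. (\<Sum>i\<le>Suc n. real (Suc n choose i) * abel_coeff x i * (y - real i) ^ (Suc n - i))
               - (x + y) ^ Suc n)"
  have "DERIV g z :> 0" for z
  proof -
    have "DERIV g z :> (\<Sum>i\<le>Suc n. real (Suc n choose i) * abel_coeff x i
              * (real (Suc n - i) * (z - real i) ^ (n - i))) - real (Suc n) * (x + z) ^ n"
    proof -
      have power: "DERIV (\<lambda>y. (y - b) ^ e) z :> real e * (z - b) ^ (e - 1)" for b :: real and e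
        by (auto intro!: derivative_eq_intros)
      have "DERIV (\<lambda>y. (y - real i) ^ (Suc n - i)) z :> real (Suc n - i) * (z - real i) ^ (n - i)"
        for i
        using power[of "real i" "Suc n - i"] by simp
      moreover have "DERIV (\<lambda>y. (x + y) ^ Suc n) z :> real (Suc n) * (x + z) ^ n"
        using power[of "- x" "Suc n"] by (simp add: add.commute)
      ultimately show ?thesis
        unfolding g_def by (intro DERIV_diff DERIV_sum DERIV_cmult)
    qed
    also have "(\<Sum>i\<le>Suc n. real (Suc n choose i) * abel_coeff x i
              * (real (Suc n - i) * (z - real i) ^ (n - i)))
        = (\<Sum>i\<le>n. real (Suc n) * (real (n choose i) * abel_coeff x i * (z - real i) ^ (n - i)))"
    proof -
      have absorb: "real (Suc n - i) * real (Suc n choose i) = real (Suc n) * real (n choose i)" for i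
        using binomial_absorb_comp[of "Suc n" i] by (metis diff_Suc_1 of_nat_mult)
      have "c * a * (s * w) = t * (b * a * w)" if "s * c = t * b" for a b c s t w :: real
        using that by algebra
      from this[OF absorb]
      have "real (Suc n choose i) * abel_coeff x i * (real (Suc n - i) * (z - real i) ^ (n - i))
          = real (Suc n) * (real (n choose i) * abel_coeff x i * (z - real i) ^ (n - i))" for i .
      then show ?thesis
        by (simp only: sum.atMost_Suc binomial_eq_0[OF lessI] of_nat_0 mult_zero_left mult_zero_right
            add_0_right)
    qed
    also have "\<dots> = real (Suc n) * (x + z) ^ n"
      by (simp only: sum_distrib_left[symmetric] Suc.IH)
    finally show ?thesis by simp
  qed
  then have "g y = g (- x)"
    using DERIV_isconst_all by blast
  also have "g (- x) = 0"
  proof -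
    have "real (Suc n choose i) * abel_coeff x i * (- x - real i) ^ (Suc n - i)
        = (-1) ^ Suc n * x * ((-1) ^ i * real (Suc n choose i) * (x + real i) ^ n)"
      if "i \<le> Suc n" for i
    proof -
      have pos: "x + real i > 0" using assms by simp
      have flip: "(- x - real i) ^ (Suc n - i) = (-1) ^ (Suc n - i) * (x + real i) ^ (Suc n - i)"
        by (simp add: power_mult_distrib[symmetric])
      moreover have "(-1 :: real) ^ (Suc n - i) = (-1) ^ Suc n * (-1) ^ i"
        using that by (auto simp: minus_one_power_iff)
      moreover have "abel_coeff x i * (x + real i) ^ (Suc n - i) = x * (x + real i) ^ n"
      proof -
        have "(x + real i) ^ i * (x + real i) ^ (Suc n - i) = (x + real i) ^ Suc n"
          using that by (simp only: power_add[symmetric]) simp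
        then show ?thesis using pos by (simp add: abel_coeff_eq[OF assms] field_simps)
      qed
      ultimately have signs: "abel_coeff x i * (- x - real i) ^ (Suc n - i)
          = (x * (x + real i) ^ n) * ((-1) ^ Suc n * (-1) ^ i)"
        unfolding flip by (metis mult.assoc mult.commute)
      have "c * a * w = s * x * (e * c * v)" if "a * w = (x * v) * (s * e)" for a c e s v w :: real
        using that by algebra
      from this[OF signs] show ?thesis .
    qed
    then have "g (- x) = (-1) ^ Suc n * x *
        (\<Sum>i\<le>Suc n. (-1) ^ i * real (Suc n choose i) * (x + real i) ^ n)"
      unfolding g_def sum_distrib_left by simp
    then show ?thesis
      using alternating_binomial_power_sum_eq_0[of n "Suc n" x] by simp
  qed
  finally show ?case by (simp add: g_def)
qed

section \<open>Failures as a passage of the preference counts\<close>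

lemma park_at_SomeD:
  assumes "park_at n Q s = Some t"
  shows "t \<notin> Q" "s \<le> t" "t \<le> n \<or> t = s"
proof -
  have "t \<notin> Q \<and> s \<le> t \<and> (t \<le> n \<or> t = s)"
  proof (cases "s \<in> Q")
    case True
    with assms have ex: "\<exists>u. u \<in> {s<..n} \<and> u \<notin> Q"
      and t: "t = (LEAST u. u \<in> {s<..n} \<and> u \<notin> Q)"
      unfolding park_at_def by (auto split: if_splits)
    show ?thesis
      using LeastI_ex[OF ex] unfolding t by auto
  qed (use assms in \<open>auto simp: park_at_def\<close>)
  then show "t \<notin> Q" "s \<le> t" "t \<le> n \<or> t = s" by auto
qed

lemma park_at_before_free_space:
  assumes "u \<notin> Q" "s \<le> u" "u \<le> n"
  shows "\<exists>t\<le>u. park_at n Q s = Some t"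
proof (cases "s \<in> Q")
  case True
  with assms have u: "u \<in> {s<..n} \<and> u \<notin> Q"
    by (cases "s = u") auto
  then have "(LEAST t. t \<in> {s<..n} \<and> t \<notin> Q) \<le> u"
    by (rule Least_le)
  with u True show ?thesis
    by (auto simp: park_at_def)
qed (use assms in \<open>simp add: park_at_def\<close>)

lemma card_filter_Suc:
  "card {j \<in> {1..Suc J}. P j} = card {j \<in> {1..J}. P j} + (if P (Suc J) then 1 else 0)"
proof -
  have "{j \<in> {1..Suc J}. P j} = {j \<in> {1..J}. P j} \<union> (if P (Suc J) then {Suc J} else {})"
    by (auto simp: le_Suc_eq)
  then show ?thesis by (simp add: card_insert_if)
qed

lemma finite_occupied: "finite (occupied n f J)"
  by (induction J) (auto split: option.splits)

lemma occupied_subset: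
  assumes "f \<in> assignments n m" "J \<le> m"
  shows "occupied n f J \<subseteq> {1..n}"
  using assms(2)
proof (induction J)
  case (Suc J)
  then have "f (Suc J) \<in> {1..n}"
    using assms(1) by (auto simp: assignments_def PiE_iff)
  with Suc show ?case
    by (force split: option.splits dest: park_at_SomeD)
qed simp

lemma failures_add_card_occupied: "failures n m f + card (occupied n f m) = m"
proof (induction m)
  case (Suc m)
  have "failures n (Suc m) f = failures n m f
      + (if park_at n (occupied n f m) (f (Suc m)) = None then 1 else 0)"
    unfolding failures_def by (subst card_filter_Suc) simp
  with Suc show ?case
    by (auto split: option.splits simp: finite_occupied dest: park_at_SomeD)
qed (simp add: failures_def)

text \<open>Nobody parks before the preferred space.\<close>

lemma card_occupied_upto_le:
  "card (occupied n f J \<inter> {..t}) \<le> card {j \<in> {1..J}. f j \<le> t}"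
proof (induction J)
  case (Suc J)
  show ?case
  proof (cases "park_at n (occupied n f J) (f (Suc J))")
    case (Some s)
    have "f (Suc J) \<le> s" using park_at_SomeD(2)[OF Some] .
    with Suc Some show ?thesis
      unfolding card_filter_Suc by (auto simp: Int_insert_left card_insert_if finite_occupied)
  next
    case None
    with Suc show ?thesis
      unfolding card_filter_Suc by simp
  qed
qed simp

text \<open>Nobody drives past a space that stays free. For \<open>t = 0\<close>, which no valid assignment ever
  occupies, the statement is trivial; including it covers the case in which all spaces are taken.\<close>

lemma card_occupied_upto_free_space_ge:
  assumes "t \<notin> occupied n f J" "t \<le> n"
  shows "card {j \<in> {1..J}. f j \<le> t} \<le> card (occupied n f J \<inter> {..t})"
  using assms(1)
proof (induction J)
  case (Suc J)
  then have free: "t \<notin> occupied n f J"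
    by (auto split: option.splits)
  show ?case
  proof (cases "f (Suc J) \<le> t")
    case True
    then obtain s where s: "s \<le> t" "park_at n (occupied n f J) (f (Suc J)) = Some s"
      using park_at_before_free_space[OF free _ assms(2)] by blast
    with True Suc.IH[OF free] park_at_SomeD(1)[OF s(2)] show ?thesis
      unfolding card_filter_Suc by (simp add: Int_insert_left finite_occupied)
  next
    case False
    have "occupied n f J \<inter> {..t} \<subseteq> occupied n f (Suc J) \<inter> {..t}"
      by (auto split: option.splits)
    then have "card (occupied n f J \<inter> {..t}) \<le> card (occupied n f (Suc J) \<inter> {..t})"
      by (intro card_mono finite_Int disjI1 finite_occupied)
    with Suc.IH[OF free] False show ?thesis
      unfolding card_filter_Suc by simp
  qed
qed simp

text \<open>The spaces after \<open>t\<close> can absorb only \<open>n - t\<close> of the drivers who prefer them, so the condition is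
  sufficient for any \<open>t\<close>. It is necessary because the bound is attained at the last free space:
  everything after it is full, and the drivers with a preference up to it all park before it.\<close>

lemma le_failures_iff:
  assumes f: "f \<in> assignments n m"
  shows "k \<le> failures n m f \<longleftrightarrow> (\<exists>t\<le>n. card {j \<in> {1..m}. f j \<le> t} + n + k \<le> t + m)"
proof -
  define Q where "Q = occupied n f m"
  have Q: "Q \<subseteq> {1..n}" "finite Q"
    using occupied_subset[OF f] finite_occupied by (auto simp: Q_def)
  have split_card: "card Q = card (Q \<inter> {..t}) + card (Q \<inter> {t<..n})" for t
  proof -
    have "Q = (Q \<inter> {..t}) \<union> (Q \<inter> {t<..n})" using Q by auto
    also have "card \<dots> = card (Q \<inter> {..t}) + card (Q \<inter> {t<..n})"
      using Q by (intro card_Un_disjoint) auto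
    finally show ?thesis .
  qed
  have fail: "failures n m f + card Q = m"
    using failures_add_card_occupied by (simp add: Q_def)
  show ?thesis
  proof
    assume k: "k \<le> failures n m f"
    \<comment> \<open>The last free space, or \<open>0\<close> if all spaces are taken.\<close>
    define t where "t = Max ({..n} - Q)"
    have "{..n} - Q \<noteq> {}" using Q by auto
    then have "t \<in> {..n} - Q"
      unfolding t_def by (intro Max_in) auto
    then have t: "t \<le> n" "t \<notin> Q" by auto
    have "s \<in> Q" if "s \<in> {t<..n}" for s
    proof (rule ccontr)
      assume "s \<notin> Q"
      then have "s \<le> t" using that unfolding t_def by (intro Max_ge) auto
      with that show False by auto
    qed
    then have "Q \<inter> {t<..n} = {t<..n}" by auto
    then have "card Q = card (Q \<inter> {..t}) + (n - t)"
      using split_card[of t] by simp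
    moreover have "card {j \<in> {1..m}. f j \<le> t} \<le> card (Q \<inter> {..t})"
      using card_occupied_upto_free_space_ge t unfolding Q_def by blast
    ultimately have "card {j \<in> {1..m}. f j \<le> t} + n + k \<le> t + m"
      using k fail t(1) by linarith
    then show "\<exists>t\<le>n. card {j \<in> {1..m}. f j \<le> t} + n + k \<le> t + m"
      using t(1) by blast
  next
    assume "\<exists>t\<le>n. card {j \<in> {1..m}. f j \<le> t} + n + k \<le> t + m"
    then obtain t where t: "t \<le> n" "card {j \<in> {1..m}. f j \<le> t} + n + k \<le> t + m" by blast
    have "card (Q \<inter> {t<..n}) \<le> n - t"
      using card_mono[of "{t<..n}" "Q \<inter> {t<..n}"] by simp
    moreover have "card (Q \<inter> {..t}) \<le> card {j \<in> {1..m}. f j \<le> t}"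
      unfolding Q_def by (rule card_occupied_upto_le)
    ultimately show "k \<le> failures n m f"
      using split_card[of t] fail t by linarith
  qed
qed

section \<open>Decomposition at the first hit\<close>

text \<open>The walk \<open>t \<mapsto> card {j \<in> A. f j \<le> t} - t\<close> starts at \<open>0\<close> and decreases by at most \<open>1\<close> per step;
  \<open>hits\<close> asks that it reaches the level \<open>- d\<close> by time \<open>n\<close>.\<close>

definition hits :: "'a set \<Rightarrow> nat \<Rightarrow> nat \<Rightarrow> ('a \<Rightarrow> nat) set" where
  "hits A n d = {f \<in> A \<rightarrow>\<^sub>E {1..n}. \<exists>t\<le>n. card {j \<in> A. f j \<le> t} + d \<le> t}"

text \<open>With all drivers of \<open>B\<close> choosing among \<open>d + card B\<close> spaces, the walk ends at the level \<open>- d\<close>; it must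
  not be there earlier.\<close>

definition first_hits :: "'a set \<Rightarrow> nat \<Rightarrow> ('a \<Rightarrow> nat) set" where
  "first_hits B d = {f \<in> B \<rightarrow>\<^sub>E {1..d + card B}. \<forall>t<d + card B. t < card {j \<in> B. f j \<le> t} + d}"

text \<open>The first hit is at \<open>d + card B\<close>, and \<open>B\<close> is the set of drivers who prefer a space up to that
  time.\<close>

definition hits_via :: "'a set \<Rightarrow> nat \<Rightarrow> nat \<Rightarrow> 'a set \<Rightarrow> ('a \<Rightarrow> nat) set" where
  "hits_via A n d B = {f \<in> A \<rightarrow>\<^sub>E {1..n}. (\<forall>j\<in>B. f j \<le> d + card B) \<and> (\<forall>j\<in>A - B. d + card B < f j)
     \<and> (\<forall>t<d + card B. t < card {j \<in> B. f j \<le> t} + d)}"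

text \<open>The drivers in \<open>B\<close> and those outside \<open>B\<close> choose independently: the condition on the walk before its
  first hit concerns \<open>B\<close> only.\<close>

lemma card_hits_via:
  assumes "finite A" "B \<subseteq> A" "d + card B \<le> n"
  shows "card (hits_via A n d B) = card (first_hits B d) * (n - (d + card B)) ^ (card A - card B)"
proof -
  have fin: "finite B" using assms finite_subset by blast
  define join where "join = (\<lambda>(u::'a \<Rightarrow> nat, v) j. if j \<in> B then u j else v j)"
  have "bij_betw (\<lambda>f. (restrict f B, restrict f (A - B)))
      (hits_via A n d B) (first_hits B d \<times> ((A - B) \<rightarrow>\<^sub>E {d + card B<..n}))"
  proof (rule bij_betw_byWitness[where f' = join])
    show "\<forall>f\<in>hits_via A n d B. join (restrict f B, restrict f (A - B)) = f"
    proof (intro ballI ext)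
      fix f j
      assume "f \<in> hits_via A n d B"
      then have "f j = undefined" if "j \<notin> A"
        using that by (auto simp: hits_via_def)
      then show "join (restrict f B, restrict f (A - B)) j = f j"
        using assms(2) by (auto simp: join_def)
    qed
    show "\<forall>p\<in>first_hits B d \<times> ((A - B) \<rightarrow>\<^sub>E {d + card B<..n}).
        (restrict (join p) B, restrict (join p) (A - B)) = p"
    proof clarify
      fix u v
      assume "u \<in> first_hits B d" "v \<in> (A - B) \<rightarrow>\<^sub>E {d + card B<..n}"
      then have "\<And>j. j \<notin> B \<Longrightarrow> u j = undefined" "\<And>j. j \<notin> A - B \<Longrightarrow> v j = undefined"
        by (auto simp: first_hits_def)
      then show "restrict (join (u, v)) B = u \<and> restrict (join (u, v)) (A - B) = v"
        by (auto simp: join_def fun_eq_iff)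
    qed
    show "(\<lambda>f. (restrict f B, restrict f (A - B))) ` hits_via A n d B
        \<subseteq> first_hits B d \<times> ((A - B) \<rightarrow>\<^sub>E {d + card B<..n})"
    proof (rule image_subsetI)
      fix f
      assume f: "f \<in> hits_via A n d B"
      then have mem: "f j \<in> {1..n}" if "j \<in> A" for j
        using that unfolding hits_via_def by blast
      have restr: "{j \<in> B. restrict f B j \<le> t} = {j \<in> B. f j \<le> t}" for t
        by auto
      have "restrict f B \<in> B \<rightarrow>\<^sub>E {1..d + card B}"
        using f mem assms(2) by (intro PiE_I) (auto simp: hits_via_def)
      moreover have "restrict f (A - B) \<in> (A - B) \<rightarrow>\<^sub>E {d + card B<..n}"
        using f mem by (intro PiE_I) (auto simp: hits_via_def)
      ultimately show "(restrict f B, restrict f (A - B))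
          \<in> first_hits B d \<times> ((A - B) \<rightarrow>\<^sub>E {d + card B<..n})"
        using f by (simp add: hits_via_def first_hits_def restr del: restrict_apply)
    qed
    show "join ` (first_hits B d \<times> ((A - B) \<rightarrow>\<^sub>E {d + card B<..n})) \<subseteq> hits_via A n d B"
    proof clarify
      fix u v
      assume u: "u \<in> first_hits B d" and v: "v \<in> (A - B) \<rightarrow>\<^sub>E {d + card B<..n}"
      have on_B: "join (u, v) j = u j" "u j \<in> {1..d + card B}" if "j \<in> B" for j
        using that u by (auto simp: join_def first_hits_def)
      have off_B: "join (u, v) j = v j" "v j \<in> {d + card B<..n}" if "j \<in> A - B" for j
        using that v by (auto simp: join_def)
      have "join (u, v) \<in> A \<rightarrow>\<^sub>E {1..n}"
      proof (rule PiE_I)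
        fix j
        assume "j \<in> A"
        then show "join (u, v) j \<in> {1..n}"
          using on_B[of j] off_B[of j] assms(3) by (cases "j \<in> B") auto
      next
        fix j
        assume "j \<notin> A"
        then show "join (u, v) j = undefined"
          using v assms(2) by (auto simp: join_def)
      qed
      moreover have "{j \<in> B. join (u, v) j \<le> t} = {j \<in> B. u j \<le> t}" for t
        by (auto simp: join_def)
      ultimately show "join (u, v) \<in> hits_via A n d B"
        using u on_B off_B by (simp add: hits_via_def first_hits_def)
    qed
  qed
  then have "card (hits_via A n d B) = card (first_hits B d \<times> ((A - B) \<rightarrow>\<^sub>E {d + card B<..n}))"
    by (rule bij_betw_same_card)
  also have "\<dots> = card (first_hits B d) * (n - (d + card B)) ^ (card A - card B)"
    using assms fin by (simp add: card_cartesian_product card_PiE card_Diff_subset)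
  finally show ?thesis .
qed

text \<open>The assignment determines the time of the first hit, hence also \<open>B\<close>; this makes the sets
  \<open>hits_via A n d B\<close> disjoint.\<close>

lemma hits_via_first_time:
  assumes "finite A" "B \<subseteq> A" "f \<in> hits_via A n d B"
  shows "(LEAST t. card {j \<in> A. f j \<le> t} + d \<le> t) = d + card B"
    and "B = {j \<in> A. f j \<le> d + card B}"
proof -
  have on_B: "f j \<le> d + card B" if "j \<in> B" for j
    using that assms(3) by (simp add: hits_via_def)
  have off_B: "d + card B < f j" if "j \<in> A" "j \<notin> B" for j
    using that assms(3) by (simp add: hits_via_def)
  have upto: "{j \<in> A. f j \<le> t} = {j \<in> B. f j \<le> t}" if "t \<le> d + card B" for t
  proof (rule Collect_cong)
    fix j
    show "j \<in> A \<and> f j \<le> t \<longleftrightarrow> j \<in> B \<and> f j \<le> t"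
      using that assms(2) off_B[of j] by (cases "j \<in> B") auto
  qed
  show B: "B = {j \<in> A. f j \<le> d + card B}"
  proof (rule set_eqI)
    fix j
    show "j \<in> B \<longleftrightarrow> j \<in> {j \<in> A. f j \<le> d + card B}"
      using assms(2) on_B[of j] off_B[of j] by (cases "j \<in> B") auto
  qed
  show "(LEAST t. card {j \<in> A. f j \<le> t} + d \<le> t) = d + card B"
  proof (rule Least_equality)
    show "card {j \<in> A. f j \<le> d + card B} + d \<le> d + card B"
      using B by simp
  next
    fix t
    assume t: "card {j \<in> A. f j \<le> t} + d \<le> t"
    show "d + card B \<le> t"
    proof (rule ccontr)
      assume "\<not> d + card B \<le> t"
      moreover from this have "t < card {j \<in> B. f j \<le> t} + d"
        using assms(3) by (auto simp: hits_via_def)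
      ultimately show False using t upto[of t] by simp
    qed
  qed
qed

lemma hits_eq_Union_hits_via:
  assumes "finite A" "d > 0"
  shows "hits A n d = (\<Union>B\<in>{B. B \<subseteq> A \<and> d + card B \<le> n}. hits_via A n d B)"
proof (intro equalityI subsetI)
  fix f
  assume f: "f \<in> hits A n d"
  define N where "N = (\<lambda>t. card {j \<in> A. f j \<le> t})"
  define T where "T = (LEAST t. N t + d \<le> t)"
  from f obtain t where t: "t \<le> n" "N t + d \<le> t" by (auto simp: hits_def N_def)
  have T: "N T + d \<le> T" unfolding T_def by (rule LeastI[of "\<lambda>t. N t + d \<le> t", OF t(2)])
  have "T \<le> t" unfolding T_def by (rule Least_le) (rule t(2))
  have before: "s < N s + d" if "s < T" for s
    using not_less_Least[of s "\<lambda>t. N t + d \<le> t"] that unfolding T_def by simp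
  \<comment> \<open>At the first hit, the walk is exactly at \<open>- d\<close>, since it was higher one step before.\<close>
  have "T > 0" using T assms by simp
  then have "T - 1 < N (T - 1) + d" by (intro before) simp
  moreover have "N (T - 1) \<le> N T"
    unfolding N_def using assms by (intro card_mono) auto
  ultimately have "T = d + N T" using T by simp
  moreover define B where "B = {j \<in> A. f j \<le> T}"
  ultimately have T_B: "T = d + card B" by (simp add: N_def)
  have "card {j \<in> B. f j \<le> s} = N s" if "s < T" for s
    unfolding N_def by (rule arg_cong[where f = card]) (use that in \<open>auto simp: B_def\<close>)
  with before have "s < card {j \<in> B. f j \<le> s} + d" if "s < T" for s
    using that by simp
  moreover have "\<forall>j\<in>B. f j \<le> T" "\<forall>j\<in>A - B. T < f j"
    by (auto simp: B_def)
  ultimately have "f \<in> hits_via A n d B"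
    using f unfolding hits_via_def hits_def T_B by blast
  moreover have "B \<subseteq> A" "d + card B \<le> n"
    using T_B \<open>T \<le> t\<close> t(1) by (auto simp: B_def)
  ultimately show "f \<in> (\<Union>B\<in>{B. B \<subseteq> A \<and> d + card B \<le> n}. hits_via A n d B)" by blast
next
  fix f
  assume "f \<in> (\<Union>B\<in>{B. B \<subseteq> A \<and> d + card B \<le> n}. hits_via A n d B)"
  then obtain B where B: "B \<subseteq> A" "d + card B \<le> n" "f \<in> hits_via A n d B" by blast
  then have "card {j \<in> A. f j \<le> d + card B} + d \<le> d + card B"
    using hits_via_first_time(2)[OF assms(1) B(1,3)] by simp
  with B show "f \<in> hits A n d"
    by (auto simp: hits_def hits_via_def)
qed

lemma card_hits_eq_sum_subsets:
  assumes "finite A" "d > 0"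
  shows "card (hits A n d) = (\<Sum>B | B \<subseteq> A \<and> d + card B \<le> n.
           card (first_hits B d) * (n - (d + card B)) ^ (card A - card B))"
proof -
  have "card (hits A n d) = (\<Sum>B | B \<subseteq> A \<and> d + card B \<le> n. card (hits_via A n d B))"
    unfolding hits_eq_Union_hits_via[OF assms]
  proof (rule card_UN_disjoint)
    show "finite {B. B \<subseteq> A \<and> d + card B \<le> n}" using assms by simp
    show "\<forall>B\<in>{B. B \<subseteq> A \<and> d + card B \<le> n}. finite (hits_via A n d B)"
      using assms(1) by (auto simp: hits_via_def intro!: finite_PiE)
    show "\<forall>B\<in>{B. B \<subseteq> A \<and> d + card B \<le> n}. \<forall>C\<in>{B. B \<subseteq> A \<and> d + card B \<le> n}.
        B \<noteq> C \<longrightarrow> hits_via A n d B \<inter> hits_via A n d C = {}"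
    proof (intro ballI impI)
      fix B C
      assume BC: "B \<in> {B. B \<subseteq> A \<and> d + card B \<le> n}" "C \<in> {B. B \<subseteq> A \<and> d + card B \<le> n}" "B \<noteq> C"
      have "B = C" if "f \<in> hits_via A n d B" "f \<in> hits_via A n d C" for f
      proof -
        have "d + card B = d + card C"
          using hits_via_first_time(1)[OF assms(1) _ that(1)] hits_via_first_time(1)[OF assms(1) _ that(2)] BC
          by simp
        with hits_via_first_time(2)[OF assms(1) _ that(1)] hits_via_first_time(2)[OF assms(1) _ that(2)] BC
        show ?thesis by simp
      qed
      with BC(3) show "hits_via A n d B \<inter> hits_via A n d C = {}" by blast
    qed
  qed
  then show ?thesis
    using card_hits_via[OF assms(1)] by simp
qed

lemma sum_subsets_by_card:
  fixes g :: "nat \<Rightarrow> real"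
  assumes "finite A"
  shows "(\<Sum>B | B \<subseteq> A \<and> P (card B). g (card B)) = (\<Sum>i | i \<le> card A \<and> P i. real (card A choose i) * g i)"
proof -
  have "(\<Sum>B | B \<subseteq> A \<and> P (card B). g (card B))
      = (\<Sum>i | i \<le> card A \<and> P i. \<Sum>B | B \<in> {B. B \<subseteq> A \<and> P (card B)} \<and> card B = i. g (card B))"
    using assms by (intro sum.group[symmetric]) (auto intro: card_mono)
  also have "\<dots> = (\<Sum>i | i \<le> card A \<and> P i. real (card A choose i) * g i)"
  proof (intro sum.cong refl)
    fix i
    assume "i \<in> {i. i \<le> card A \<and> P i}"
    then have "{B \<in> {B. B \<subseteq> A \<and> P (card B)}. card B = i} = {B. B \<subseteq> A \<and> card B = i}" by auto
    then show "(\<Sum>B | B \<in> {B. B \<subseteq> A \<and> P (card B)} \<and> card B = i. g (card B)) = real (card A choose i) * g i"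
      using n_subsets[OF assms, of i] by simp
  qed
  finally show ?thesis .
qed

text \<open>If the \<open>card A\<close> drivers choose among \<open>d + card A\<close> spaces, the walk ends at \<open>- d\<close>, so every
  assignment hits. Decomposing all \<open>(d + card A)^card A\<close> assignments at the first hit expresses
  \<open>first_hits A d\<close> by the same numbers for smaller sets, and Abel's identity solves this recursion.\<close>

lemma card_first_hits:
  fixes A :: "'a set"
  assumes "finite A" "d > 0"
  shows "real (card (first_hits A d)) = abel_coeff (real d) (card A)"
  using assms(1)
proof (induction A rule: finite_psubset_induct)
  case (psubset A)
  define a where "a = card A"
  let ?n = "d + a"
  have le: "card B \<le> a" if "B \<subseteq> A" for B
    using that psubset.hyps by (simp add: card_mono a_def)
  have "hits A ?n d = A \<rightarrow>\<^sub>E {1..?n}"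
  proof -
    have "card {j \<in> A. f j \<le> ?n} + d \<le> ?n" for f
      using le[of "{j \<in> A. f j \<le> ?n}"] by auto
    then show ?thesis by (auto simp: hits_def)
  qed
  then have "real ?n ^ a = real (card (hits A ?n d))"
    using psubset.hyps by (simp add: card_PiE a_def)
  also have "\<dots> = (\<Sum>B | B \<subseteq> A. real (card (first_hits B d)) * real (a - card B) ^ (a - card B))"
    unfolding card_hits_eq_sum_subsets[OF psubset.hyps assms(2)] a_def[symmetric] using le
    by (simp cong: conj_cong)
  also have "\<dots> = real (card (first_hits A d)) +
      (\<Sum>B\<in>{B. B \<subseteq> A} - {A}. real (card (first_hits B d)) * real (a - card B) ^ (a - card B))"
    by (subst sum.remove[of _ A]) (use psubset.hyps in \<open>simp_all add: a_def\<close>)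
  also have "(\<Sum>B\<in>{B. B \<subseteq> A} - {A}. real (card (first_hits B d)) * real (a - card B) ^ (a - card B))
      = (\<Sum>B\<in>{B. B \<subseteq> A} - {A}. abel_coeff d (card B) * real (a - card B) ^ (a - card B))"
    using psubset.IH by (intro sum.cong) auto
  also have "\<dots> = (\<Sum>B | B \<subseteq> A. abel_coeff d (card B) * real (a - card B) ^ (a - card B)) - abel_coeff d a"
    by (subst sum.remove[of "{B. B \<subseteq> A}" A]) (use psubset.hyps in \<open>simp_all add: a_def\<close>)
  also have "(\<Sum>B | B \<subseteq> A. abel_coeff d (card B) * real (a - card B) ^ (a - card B))
      = (\<Sum>i\<le>a. real (a choose i) * (abel_coeff d i * real (a - i) ^ (a - i)))"
    using sum_subsets_by_card[OF psubset.hyps, where P = "\<lambda>_. True"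
        and g = "\<lambda>i. abel_coeff d i * real (a - i) ^ (a - i)"]
    by (simp only: a_def atMost_def simp_thms)
  also have "\<dots> = (\<Sum>i\<le>a. real (a choose i) * abel_coeff d i * (real a - real i) ^ (a - i))"
    by (intro sum.cong) (auto simp: of_nat_diff)
  also have "\<dots> = real ?n ^ a"
    using abel_identity[of "real d" a "real a"] assms(2) by simp
  finally show ?case by (simp add: a_def)
qed

section \<open>The number of assignments with at least k failures\<close>

text \<open>
  In the first branch of \<open>S\<close>, more drivers arrive than there are spaces by at least \<open>k\<close>. In the second, \<open>d\<close>
  is positive and the sum over the possible sets of early drivers depends on their number only.\<close>

lemma card_at_least_k_failures:
  "real (card {f \<in> assignments n m. k \<le> failures n m f}) = S n m k"
proof (cases "int k \<le> int m - int n")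
  case True
  have "k \<le> failures n m f" if f: "f \<in> assignments n m" for f
  proof -
    have "{j \<in> {1..m}. f j \<le> 0} = {}"
      using PiE_mem[OF f[unfolded assignments_def]] by fastforce
    then have "card {j \<in> {1..m}. f j \<le> 0} + n + k \<le> 0 + m"
      using True by (simp only: card.empty)
    then show ?thesis
      unfolding le_failures_iff[OF f] by blast
  qed
  then have "{f \<in> assignments n m. k \<le> failures n m f} = assignments n m" by blast
  with True show ?thesis
    by (simp add: S_def assignments_def card_PiE)
next
  case False
  define d where "d = n + k - m"
  from False have d: "d > 0" "d + m = n + k" unfolding d_def by linarith+
  have "{f \<in> assignments n m. k \<le> failures n m f} = hits {1..m} n d"
  proof -
    have "card {j \<in> {1..m}. f j \<le> t} + n + k \<le> t + m \<longleftrightarrow> card {j \<in> {1..m}. f j \<le> t} + d \<le> t"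
      for f :: "nat \<Rightarrow> nat" and t
      using d(2) by linarith
    then show ?thesis
      using le_failures_iff unfolding hits_def assignments_def by blast
  qed
  then have "real (card {f \<in> assignments n m. k \<le> failures n m f})
      = (\<Sum>B | B \<subseteq> {1..m} \<and> d + card B \<le> n.
           real (card (first_hits B d)) * real (n - (d + card B)) ^ (m - card B))"
    by (simp only: card_hits_eq_sum_subsets[OF finite_atLeastAtMost d(1)] of_nat_sum of_nat_mult
        of_nat_power card_atLeastAtMost diff_Suc_1 add_diff_cancel_right' Suc_eq_plus1)
  also have "\<dots> = (\<Sum>B | B \<subseteq> {1..m} \<and> d + card B \<le> n.
           abel_coeff d (card B) * real (n - (d + card B)) ^ (m - card B))"
    by (intro sum.cong refl arg_cong2[where f = "(*)"] card_first_hits d(1))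
       (auto intro: finite_subset[OF _ finite_atLeastAtMost])
  also have "\<dots> = (\<Sum>i | i \<le> m \<and> d + i \<le> n.
      real (m choose i) * (abel_coeff d i * real (n - (d + i)) ^ (m - i)))"
    using sum_subsets_by_card[of "{1..m}", where P = "\<lambda>i. d + i \<le> n"] by simp
  also have "\<dots> = S n m k"
  proof -
    have "real n - real m + real k = real d" using d(2) by linarith
    moreover have "{i. i \<le> m \<and> d + i \<le> n} = {i. i + k \<le> m}" using d by auto
    moreover have "real (n - (d + i)) = real m - real k - real i" if "i + k \<le> m" for i
      using that d by linarith
    ultimately show ?thesis
      using False unfolding S_def by (simp add: abel_coeff_def mult_ac del: of_nat_diff of_nat_add)
  qed
  finally show ?thesis .
qed

lemma fail_prob_eq:
  assumes "n > 0"
  shows "fail_prob n m k = S n m k / real n ^ m"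
proof -
  have "finite (assignments n m)" "assignments n m \<noteq> {}"
    unfolding assignments_def using assms by (auto simp: PiE_eq_empty_iff intro!: finite_PiE)
  moreover have "card (assignments n m) = n ^ m"
    by (simp add: assignments_def card_PiE)
  moreover have "assignments n m \<inter> {f. k \<le> failures n m f} = {f \<in> assignments n m. k \<le> failures n m f}"
    by blast
  ultimately show ?thesis
    by (simp add: fail_prob_def measure_pmf_of_set card_at_least_k_failures)
qed

section \<open>Comparison of the two ratios\<close>

text \<open>Weierstrass' product inequality.\<close>

lemma one_minus_sum_le_prod:
  fixes z :: "nat \<Rightarrow> real"
  assumes "finite J" "\<And>j. j \<in> J \<Longrightarrow> 0 \<le> z j" "\<And>j. j \<in> J \<Longrightarrow> z j \<le> 1"
  shows "1 - (\<Sum>j\<in>J. z j) \<le> (\<Prod>j\<in>J. 1 - z j)"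
  using assms
proof (induction J rule: finite_induct)
  case (insert a J)
  have "(\<Prod>j\<in>J. 1 - z j) \<le> 1"
    using insert.prems by (intro prod_le_1) auto
  then have "z a * (\<Prod>j\<in>J. 1 - z j) \<le> z a"
    using insert.prems by (simp add: mult_left_le)
  with insert show ?case
    by (auto simp: algebra_simps)
qed simp

text \<open>The factors by which the Abel terms for \<open>D + k\<close> and for \<open>D - k\<close> drivers differ from those for \<open>D\<close>
  drivers, up to factors that do not depend on the summation index. For \<open>k\<close> small compared with \<open>M\<close>,
  both are close to \<open>exp (- k\<^sup>2 / (2 M))\<close>.\<close>

definition rising_ratio :: "nat \<Rightarrow> real \<Rightarrow> real" where
  "rising_ratio k M = (\<Prod>j=1..k. 1 / (1 + real j / M))"

definition falling_ratio :: "nat \<Rightarrow> real \<Rightarrow> real" where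
  "falling_ratio k M = (\<Prod>j<k. 1 - real j / M)"

lemma sum_squares_le_cube: "(\<Sum>j<k. (real j)\<^sup>2) \<le> real k ^ 3"
proof -
  have "(\<Sum>j<k. (real j)\<^sup>2) \<le> (\<Sum>j<k. (real k)\<^sup>2)"
    by (intro sum_mono power_mono) auto
  then show ?thesis by (simp add: power3_eq_cube power2_eq_square)
qed

lemma min_one_square_le: "(r::real) \<ge> 0 \<Longrightarrow> min 1 (r\<^sup>2) \<le> r"
  by (cases "r \<le> 1") (simp_all add: power2_eq_square mult_left_le min.coboundedI1 min.coboundedI2)

text \<open>Let \<open>R = (\<Prod>j<k. 1 / (1 + j / M))\<close>, the rising ratio with its indices shifted down by one. Expanding
  \<open>1 / R\<close> gives \<open>R = O(M / k\<^sup>2)\<close>, which makes up for the large relative error when \<open>M\<close> is small. The shift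
  of indices costs a relative error \<open>k / (M + k)\<close>, hence \<open>O(1 / k)\<close>. The falling ratio is \<open>R * (\<Prod>j<k. 1 - j\<^sup>2 / M\<^sup>2)\<close>,
  so its relative error is at most \<open>min 1 (k\<^sup>3 / M\<^sup>2)\<close>. As \<open>min 1 (r\<^sup>2) \<le> r\<close>
  for \<open>r \<ge> 0\<close>, this is at most \<open>k * sqrt k / M\<close>, hence the absolute error is \<open>O(1 / sqrt k)\<close>. The bound does not
  depend on \<open>M\<close>. For \<open>k > M\<close> the Abel term for \<open>D - k\<close> drivers is absent, so \<open>0\<close> replaces the product.\<close>

lemma abs_rising_minus_falling_ratio_le:
  fixes k M :: nat
  assumes "M \<ge> 1" "k \<ge> 2"
  shows "\<bar>rising_ratio k M
          - (if k \<le> M then falling_ratio k M else 0)\<bar> \<le> 2 * (sqrt k + 1) / (real k - 1)"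
proof -
  define R where "R = (\<Prod>j<k. 1 / (1 + real j / M))"
  define F where "F = (if k \<le> M then falling_ratio k M else 0)"
  have R_pos: "R > 0" unfolding R_def by (intro prod_pos) (auto intro!: divide_pos_pos add_pos_nonneg)
  have R_le: "R \<le> 2 * M / (k * (real k - 1))"
  proof -
    have gauss: "(\<Sum>j<k. real j) = k * (real k - 1) / 2"
      by (induction k) (auto simp: field_simps)
    have "k * (real k - 1) / (2 * M) = (\<Sum>j<k. real j) / M"
      unfolding gauss by simp
    also have "\<dots> = (\<Sum>j<k. real j / M)"
      by (simp add: sum_divide_distrib)
    also have "\<dots> \<le> (\<Prod>j<k. 1 + real j / M)"
      by (rule sum_le_prod) auto
    also have "\<dots> = inverse R"
      unfolding R_def by (simp add: prod_inversef[symmetric] divide_inverse)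
    finally show ?thesis
      using R_pos assms by (simp add: field_simps)
  qed
  have rising: "rising_ratio k M = R - R * (k / (M + k))"
  proof -
    have "rising_ratio k M = R * (1 / (1 + real k / M))"
      unfolding rising_ratio_def R_def
      using prod.lessThan_Suc_shift[of "\<lambda>j. 1 / (1 + real j / M)" k]
      by (simp add: prod.atLeast1_atMost_eq)
    also have "\<dots> = R - R * (k / (M + k))"
      using assms by (simp add: field_simps)
    finally show ?thesis .
  qed
  have "R * (k / (M + k)) \<le> 2 / (real k - 1)"
  proof -
    have "R * (k / (M + k)) \<le> 2 * M / (k * (real k - 1)) * (k / (M + k))"
      by (intro mult_right_mono R_le) auto
    also have "\<dots> = 2 / (real k - 1) * (M / (M + k))"
      using assms by simp
    also have "\<dots> \<le> 2 / (real k - 1)"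
      using assms by (intro mult_left_le) (auto simp: divide_le_eq)
    finally show ?thesis .
  qed
  moreover have "R * (k / (M + k)) \<ge> 0" using R_pos by simp
  moreover have "F \<le> R"
  proof (cases "k \<le> M")
    case True
    have "1 - real j / M \<le> 1 / (1 + real j / M)" for j
      using assms by (simp add: field_simps)
    with True show ?thesis
      unfolding F_def falling_ratio_def R_def by (auto intro!: prod_mono simp: divide_le_eq)
  qed (use R_pos in \<open>simp add: F_def\<close>)
  moreover have "R - F \<le> 2 * sqrt k / (real k - 1)"
  proof -
    define r where "r = k * sqrt k / M"
    have r2: "r\<^sup>2 = real k ^ 3 / M\<^sup>2"
      by (simp add: r_def power_divide power_mult_distrib power3_eq_cube power2_eq_square)
    have "F \<ge> R * (1 - r\<^sup>2)"
    proof (cases "k \<le> M")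
      case True
      have "1 - r\<^sup>2 \<le> 1 - (\<Sum>j<k. (real j)\<^sup>2 / M\<^sup>2)"
        using sum_squares_le_cube[of k] unfolding r2 
        by (simp add: sum_divide_distrib[symmetric] divide_right_mono)
      also have "\<dots> \<le> (\<Prod>j<k. 1 - (real j)\<^sup>2 / M\<^sup>2)"
        using True by (intro one_minus_sum_le_prod) (auto simp: divide_le_eq)
      finally have "R * (1 - r\<^sup>2) \<le> R * (\<Prod>j<k. 1 - (real j)\<^sup>2 / M\<^sup>2)"
        using R_pos by simp
      also have "\<dots> = F"
      proof -
        have "1 / (1 + q) * (1 - q\<^sup>2) = 1 - q" if "q \<ge> 0" for q :: real
          using that by (simp add: field_simps power2_eq_square)
        from this[of "real j / M" for j]
        have "1 / (1 + real j / M) * (1 - (real j)\<^sup>2 / M\<^sup>2) = 1 - real j / M" for j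
          by (simp add: power_divide)
        with True show ?thesis
          unfolding F_def R_def falling_ratio_def prod.distrib[symmetric] by simp
      qed
      finally show ?thesis .
    next
      case False
      then have "real M ^ 2 \<le> real k ^ 3"
        using assms power_mono[of "real M" "real k" 2] power_increasing[of 2 3 "real k"] by linarith
      then have "r\<^sup>2 \<ge> 1" using assms unfolding r2 by simp
      then show ?thesis using False R_pos by (simp add: F_def mult_nonneg_nonpos)
    qed
    moreover have "F \<ge> 0"
      unfolding F_def falling_ratio_def by (auto intro!: prod_nonneg simp: divide_le_eq)
    ultimately have "R - F \<le> R * min 1 (r\<^sup>2)"
      by (auto simp: min_def algebra_simps)
    also have "\<dots> \<le> R * r"
      using R_pos by (intro mult_left_mono min_one_square_le) (auto simp: r_def)
    also have "\<dots> \<le> 2 * M / (k * (real k - 1)) * r"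
      by (intro mult_right_mono R_le) (auto simp: r_def)
    also have "\<dots> = 2 * sqrt k / (real k - 1)"
      using assms by (simp add: r_def)
    finally show ?thesis .
  qed
  moreover have "2 * (sqrt k + 1) / (real k - 1) = 2 * sqrt k / (real k - 1) + 2 / (real k - 1)"
    by (simp add: add_divide_distrib)
  ultimately show ?thesis
    unfolding F_def[symmetric] rising using assms
    by (smt (verit) divide_nonneg_nonneg of_nat_le_iff of_nat_1 one_le_numeral order_trans of_nat_numeral real_sqrt_ge_0_iff of_nat_0_le_iff mult_nonneg_nonneg)
qed

section \<open>Reflection between k surplus and k missing drivers\<close>

text \<open>The probability that \<open>D\<close> drivers with \<open>d + D\<close> spaces have their first hit of \<open>- d\<close> at time \<open>d + i\<close>.\<close>

definition hit_weight :: "nat \<Rightarrow> nat \<Rightarrow> nat \<Rightarrow> real" where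
  "hit_weight d D i = real (D choose i) * abel_coeff d i * real (D - i) ^ (D - i) / real (d + D) ^ D"

lemma hit_weight_nonneg: "0 \<le> hit_weight d D i"
  by (simp add: hit_weight_def abel_coeff_def)

lemma sum_hit_weight_le_1:
  assumes "d > 0"
  shows "(\<Sum>i<D. hit_weight d D i) \<le> 1"
proof -
  have "(\<Sum>i<D. hit_weight d D i) \<le> (\<Sum>i\<le>D. hit_weight d D i)"
    by (intro sum_mono2) (auto simp: hit_weight_nonneg)
  also have "\<dots> = (\<Sum>i\<le>D. real (D choose i) * abel_coeff d i * (real D - real i) ^ (D - i))
      / real (d + D) ^ D"
    unfolding hit_weight_def sum_divide_distrib by (intro sum.cong) (auto simp: of_nat_diff)
  also have "\<dots> = 1"
    using assms by (subst abel_identity) auto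
  finally show ?thesis .
qed

lemma binomial_add_eq_rising_ratio:
  fixes r :: real
  assumes "i < D" "r > 0"
  shows "real ((D + k) choose i) * real (D - i) ^ (D + k - i) / r ^ k
    = real (D choose i) * real (D - i) ^ (D - i)
      * ((\<Prod>j=1..k. real (D + j) / r) * rising_ratio k (real (D - i)))"
proof (induction k)
  case 0
  then show ?case by (simp add: rising_ratio_def)
next
  case (Suc k)
  define M where "M = D - i"
  have M: "real M > 0" "D + k - i = M + k" "D + Suc k - i = M + Suc k"
    using assms(1) by (auto simp: M_def)
  have "real (M + Suc k) * real ((D + Suc k) choose i) = real (D + Suc k) * real ((D + k) choose i)"
    using binomial_absorb_comp[of "D + Suc k" i] unfolding M(3)
    by (simp only: of_nat_mult[symmetric] add_Suc_right diff_Suc_1)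
  then have choose: "real ((D + Suc k) choose i)
      = real (D + Suc k) / real (M + Suc k) * real ((D + k) choose i)"
    by (simp add: field_simps)
  have factor: "real M / real (M + Suc k) = 1 / (1 + real (Suc k) / M)"
    using M(1) by (simp add: field_simps)
  have "real ((D + Suc k) choose i) * real M ^ (M + Suc k) / r ^ Suc k
      = (real (D + Suc k) / r) * (real M / real (M + Suc k))
        * (real ((D + k) choose i) * real M ^ (M + k) / r ^ k)"
    unfolding choose by (simp add: mult_ac)
  also have "\<dots> = (real (D + Suc k) / r) * (1 / (1 + real (Suc k) / M))
      * (real (D choose i) * real M ^ M * ((\<Prod>j=1..k. real (D + j) / r) * rising_ratio k M))"
    using Suc.IH unfolding factor M_def[symmetric] M(2) by simp
  also have "\<dots> = real (D choose i) * real M ^ M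
      * ((\<Prod>j=1..Suc k. real (D + j) / r) * rising_ratio (Suc k) M)"
    by (simp add: rising_ratio_def)
  finally show ?case
    unfolding M_def[symmetric] M(3) .
qed

lemma binomial_diff_eq_falling_ratio:
  fixes r :: real
  assumes "i < D" "r > 0" "k \<le> D - i"
  shows "real ((D - k) choose i) * real (D - i) ^ (D - k - i) * r ^ k * (\<Prod>j<k. real (D - j) / r)
    = real (D choose i) * real (D - i) ^ (D - i) * falling_ratio k (real (D - i))"
  using assms(3)
proof (induction k)
  case 0
  then show ?case by (simp add: falling_ratio_def)
next
  case (Suc k)
  define M where "M = D - i"
  have M: "real M > 0" "D - k - i = Suc (D - Suc k - i)" "real (M - k) = real M - real k"
    using assms(1) Suc.prems by (auto simp: M_def of_nat_diff)
  have "(D - k - i) * ((D - k) choose i) = (D - k) * ((D - Suc k) choose i)"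
    using binomial_absorb_comp[of "D - k" i] by simp
  moreover have "D - k - i = M - k" by (simp add: M_def)
  ultimately have choose: "real (D - k) * real ((D - Suc k) choose i)
      = (real M - real k) * real ((D - k) choose i)"
    by (metis M(3) of_nat_mult)
  have "real ((D - Suc k) choose i) * real M ^ (D - Suc k - i) * r ^ Suc k
        * (\<Prod>j<Suc k. real (D - j) / r)
      = (real (D - k) * real ((D - Suc k) choose i)) * real M ^ (D - Suc k - i) * r ^ k
        * (\<Prod>j<k. real (D - j) / r)"
    using assms(2) by simp
  also have "\<dots> = (real M - real k) / M * (real ((D - k) choose i) * real M ^ (D - k - i) * r ^ k
        * (\<Prod>j<k. real (D - j) / r))"
    unfolding choose M(2) using M(1) by simp
  also have "\<dots> = (real M - real k) / M * (real (D choose i) * real M ^ M * falling_ratio k M)"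
    using Suc unfolding M_def[symmetric] by simp
  also have "\<dots> = real (D choose i) * real M ^ M * falling_ratio (Suc k) M"
    using M(1) by (simp add: falling_ratio_def diff_divide_distrib)
  finally show ?case
    unfolding M_def[symmetric] .
qed

text \<open>The term \<open>i = D\<close> of \<open>S\<close> contains the factor \<open>0^k\<close>, so the sum can be restricted to \<open>i < D\<close>, where the
  ratios are defined.\<close>

lemma S_eq_rising_sum:
  assumes "d > 0" "k > 0"
  shows "S (d + D) (D + k) k / real (d + D) ^ (D + k)
    = (\<Prod>j=1..k. real (D + j) / real (d + D))
      * (\<Sum>i<D. hit_weight d D i * rising_ratio k (real (D - i)))"
proof -
  define r where "r = real (d + D)"
  have r: "r > 0" using assms by (simp add: r_def)
  have "S (d + D) (D + k) k = (\<Sum>i\<le>D. real ((D + k) choose i) * abel_coeff d i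
      * (real D - real i) ^ (D + k - i))"
    using assms unfolding S_def by (auto intro!: sum.cong simp: abel_coeff_def)
  also have "\<dots> = (\<Sum>i<D. real ((D + k) choose i) * abel_coeff d i * real (D - i) ^ (D + k - i))"
    using assms(2) by (simp add: lessThan_Suc_atMost[symmetric] of_nat_diff)
  finally have "S (d + D) (D + k) k / r ^ (D + k) = (\<Sum>i<D. abel_coeff d i / r ^ D
      * (real ((D + k) choose i) * real (D - i) ^ (D + k - i) / r ^ k))"
    by (simp add: sum_divide_distrib power_add mult_ac)
  also have "\<dots> = (\<Sum>i<D. (\<Prod>j=1..k. real (D + j) / r)
      * (hit_weight d D i * rising_ratio k (real (D - i))))"
    using binomial_add_eq_rising_ratio[OF _ r]
    by (intro sum.cong refl) (simp add: hit_weight_def r_def)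
  finally show ?thesis
    by (simp only: r_def sum_distrib_left)
qed

text \<open>Abel's identity for \<open>D - k\<close> drivers and \<open>d + D\<close> spaces: they reach the level \<open>- d\<close> with certainty, since
  their walk ends at \<open>- d - k\<close>.\<close>

lemma falling_prod_eq_sum:
  assumes "d > 0" "k > 0" "k \<le> D"
  shows "(\<Prod>j<k. real (D - j) / real (d + D))
    = (\<Sum>i<D. hit_weight d D i * (if k \<le> D - i then falling_ratio k (real (D - i)) else 0))"
proof -
  define r where "r = real (d + D)"
  define L where "L = (\<Prod>j<k. real (D - j) / r)"
  have r: "r > 0" using assms by (simp add: r_def)
  have sub: "{..D - k} \<subseteq> {..<D}" "\<And>i. i \<in> {..<D} - {..D - k} \<Longrightarrow> \<not> k \<le> D - i"
    using assms by auto
  have "(\<Sum>i<D. hit_weight d D i * (if k \<le> D - i then falling_ratio k (real (D - i)) else 0))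
      = (\<Sum>i\<le>D - k. hit_weight d D i * falling_ratio k (real (D - i)))"
    using sub assms(3) by (intro sum.mono_neutral_cong_right) auto
  also have "\<dots> = (\<Sum>i\<le>D - k. L * (r ^ k / r ^ D
      * (real ((D - k) choose i) * abel_coeff d i * (real D - real i) ^ (D - k - i))))"
  proof (intro sum.cong refl)
    fix i
    assume "i \<in> {..D - k}"
    then have i: "i < D" "k \<le> D - i" using assms by auto
    have "hit_weight d D i * falling_ratio k (real (D - i)) = abel_coeff d i / r ^ D
        * (real (D choose i) * real (D - i) ^ (D - i) * falling_ratio k (real (D - i)))"
      by (simp add: hit_weight_def r_def)
    also have "\<dots> = abel_coeff d i / r ^ D
        * (real ((D - k) choose i) * real (D - i) ^ (D - k - i) * r ^ k * L)"
      unfolding L_def using binomial_diff_eq_falling_ratio[OF i(1) r i(2)] by simp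
    finally show "hit_weight d D i * falling_ratio k (real (D - i)) = L * (r ^ k / r ^ D
      * (real ((D - k) choose i) * abel_coeff d i * (real D - real i) ^ (D - k - i)))"
      using i by (simp add: of_nat_diff)
  qed
  also have "\<dots> = L * (r ^ k / r ^ D * r ^ (D - k))"
    using abel_identity[of "real d" "D - k" "real D"] assms(1)
    by (simp only: sum_distrib_left[symmetric] r_def of_nat_add of_nat_0_less_iff)
  also have "\<dots> = L"
    using r assms(3) by (simp add: power_add[symmetric])
  finally show ?thesis by (simp add: L_def r_def)
qed

lemma rising_prod_eq:
  fixes D :: nat
  assumes "D > 0"
  shows "(\<Prod>j=1..k. real (D + j) / r) = (real D / r) ^ k / rising_ratio k D"
proof -
  have "real (D + j) = real D * (1 + real j / D)" for j
    using assms by (simp add: field_simps)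
  then have "(\<Prod>j=1..k. real (D + j) / r) = (\<Prod>j=1..k. (real D / r) * (1 + real j / D))"
    by simp
  also have "\<dots> = (real D / r) ^ k * (\<Prod>j=1..k. 1 + real j / D)"
    by (simp only: prod.distrib prod_constant card_atLeastAtMost diff_Suc_1)
  finally show ?thesis
    by (simp add: rising_ratio_def prod_dividef)
qed

lemma falling_prod_eq:
  fixes D :: nat
  assumes "D > 0" "k \<le> D"
  shows "(\<Prod>j<k. real (D - j) / r) = (real D / r) ^ k * falling_ratio k D"
proof -
  have "real (D - j) = real D * (1 - real j / D)" if "j < k" for j
    using assms that by (simp add: field_simps of_nat_diff)
  then have "(\<Prod>j<k. real (D - j) / r) = (\<Prod>j<k. (real D / r) * (1 - real j / D))"
    by (intro prod.cong) auto
  then show ?thesis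
    by (simp only: falling_ratio_def prod.distrib prod_constant card_lessThan)
qed

lemma inverse_rising_ratio_le:
  fixes D :: nat
  assumes "D > 0"
  shows "1 / rising_ratio k D \<le> exp (real k ^ 2 / D)"
proof -
  have "1 / rising_ratio k D = (\<Prod>j=1..k. 1 + real j / D)"
    by (simp add: rising_ratio_def prod_dividef)
  also have "\<dots> \<le> (\<Prod>j=1..k. exp (real k / D))"
  proof (intro prod_mono conjI)
    fix j
    assume "j \<in> {1..k}"
    then have "1 + real j / D \<le> 1 + real k / D"
      using assms by (simp add: divide_right_mono)
    also have "\<dots> \<le> exp (real k / D)" by (rule exp_ge_add_one_self)
    finally show "1 + real j / D \<le> exp (real k / D)" .
  qed auto
  also have "\<dots> = exp (real k ^ 2 / D)"
    by (simp add: exp_of_nat_mult[symmetric] power2_eq_square)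
  finally show ?thesis .
qed

text \<open>This is the reflection step. Write \<open>q = D / n\<close> and let \<open>R\<close> and \<open>F\<close> be the ratios for \<open>M = D\<close>. Then
  \<open>S / n^m = q^k / R * P\<close>, where the weighted sum \<open>P\<close> of rising ratios is close to the weighted sum \<open>N\<close> of
  falling ratios, and \<open>N = q^k * F\<close> by Abel's identity. The result is near \<open>q^(2 k) * F / R\<close>, and \<open>F / R\<close>
  is near \<open>1\<close> by the same comparison of ratios.\<close>

lemma abs_S_minus_power_le:
  assumes "d > 0" "2 \<le> k" "k \<le> D"
  shows "\<bar>S (d + D) (D + k) k / real (d + D) ^ (D + k) - (real D / real (d + D)) ^ (2 * k)\<bar>
    \<le> 2 * exp (real k ^ 2 / D) * (2 * (sqrt k + 1) / (real k - 1))"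
proof -
  define q where "q = real D / real (d + D)"
  define \<epsilon> where "\<epsilon> = 2 * (sqrt k + 1) / (real k - 1)"
  define R where "R = rising_ratio k D"
  define F where "F = falling_ratio k D"
  define P where "P = (\<Sum>i<D. hit_weight d D i * rising_ratio k (real (D - i)))"
  define N where "N = (\<Sum>i<D. hit_weight d D i * (if k \<le> D - i then falling_ratio k (real (D - i)) else 0))"
  have q: "0 \<le> q" "q \<le> 1" by (auto simp: q_def divide_le_eq_1)
  have R: "R > 0"
    unfolding R_def rising_ratio_def by (intro prod_pos) (auto intro!: divide_pos_pos add_pos_nonneg)
  have \<epsilon>: "\<epsilon> \<ge> 0" using assms by (simp add: \<epsilon>_def)
  have S_eq: "S (d + D) (D + k) k / real (d + D) ^ (D + k) = q ^ k / R * P"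
    using S_eq_rising_sum[of d k D] rising_prod_eq[where D = D and k = k and r = "real (d + D)"] assms
    by (simp add: P_def R_def q_def)
  have N_eq: "N = q ^ k * F"
    using falling_prod_eq_sum[of d k D] falling_prod_eq[where D = D and k = k and r = "real (d + D)"] assms
    by (simp add: N_def F_def q_def)
  have "\<bar>P - N\<bar> \<le> (\<Sum>i<D. hit_weight d D i * \<epsilon>)"
  proof -
    have "P - N = (\<Sum>i<D. hit_weight d D i * (rising_ratio k (real (D - i))
        - (if k \<le> D - i then falling_ratio k (real (D - i)) else 0)))"
      by (simp add: P_def N_def sum_subtractf right_diff_distrib)
    also have "\<bar>\<dots>\<bar> \<le> (\<Sum>i<D. hit_weight d D i * \<epsilon>)"
    proof (rule order_trans[OF sum_abs], rule sum_mono)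
      fix i
      assume "i \<in> {..<D}"
      then have "\<bar>rising_ratio k (real (D - i))
          - (if k \<le> D - i then falling_ratio k (real (D - i)) else 0)\<bar> \<le> \<epsilon>"
        unfolding \<epsilon>_def using assms by (intro abs_rising_minus_falling_ratio_le) auto
      then show "\<bar>hit_weight d D i * (rising_ratio k (real (D - i))
        - (if k \<le> D - i then falling_ratio k (real (D - i)) else 0))\<bar> \<le> hit_weight d D i * \<epsilon>"
        unfolding abs_mult abs_of_nonneg[OF hit_weight_nonneg]
        by (rule mult_left_mono[OF _ hit_weight_nonneg])
    qed
    finally show ?thesis .
  qed
  also have "\<dots> \<le> \<epsilon>"
    using mult_right_mono[OF sum_hit_weight_le_1[OF assms(1), of D] \<epsilon>] by (simp add: sum_distrib_right)
  finally have PN: "\<bar>P - N\<bar> \<le> \<epsilon>" .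
  have RF: "\<bar>F - R\<bar> \<le> \<epsilon>"
    using abs_rising_minus_falling_ratio_le[where M = D and k = k] assms by (simp add: \<epsilon>_def R_def F_def abs_minus_commute)
  have "q ^ k / R * P - q ^ (2 * k) = q ^ k / R * ((P - N) + q ^ k * (F - R))"
    using R by (simp add: N_eq field_simps power_mult power2_eq_square mult_2 power_add)
  also have "\<bar>\<dots>\<bar> \<le> 1 / R * (\<epsilon> + 1 * \<epsilon>)"
    unfolding abs_mult
  proof (intro mult_mono)
    show "\<bar>q ^ k / R\<bar> \<le> 1 / R"
      using q R by (simp add: power_le_one divide_right_mono)
    have "\<bar>q ^ k * (F - R)\<bar> \<le> 1 * \<epsilon>"
      unfolding abs_mult using q RF by (intro mult_mono) (auto simp: power_le_one)
    then show "\<bar>P - N + q ^ k * (F - R)\<bar> \<le> \<epsilon> + 1 * \<epsilon>"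
      using PN by linarith
  qed (use R in auto)
  also have "\<dots> \<le> exp (real k ^ 2 / D) * (\<epsilon> + 1 * \<epsilon>)"
    using inverse_rising_ratio_le[where D = D and k = k] assms \<epsilon> unfolding R_def by (intro mult_right_mono) auto
  finally show ?thesis
    unfolding S_eq q_def[symmetric] \<epsilon>_def[symmetric] by simp
qed

text \<open>From \<open>1 + z \<le> exp z\<close> for \<open>z = d / D\<close> and for \<open>z = - d / (d + D)\<close>.\<close>

lemma power_bounds_exp:
  fixes d D k :: nat
  assumes "D > 0"
  shows "exp (- (2 * (real k * real d / real D))) \<le> (real D / real (d + D)) ^ (2 * k)"
    and "(real D / real (d + D)) ^ (2 * k) \<le> exp (- (2 * (real k * real d / real (d + D))))"
proof -
  have "1 / (real D / real (d + D)) \<le> exp (real d / D)"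
    using assms exp_ge_add_one_self[of "real d / D"] by (simp add: field_simps)
  then have "exp (- (real d / D)) \<le> real D / real (d + D)"
    using assms by (simp add: exp_minus field_simps)
  then have "exp (- (real d / D)) ^ (2 * k) \<le> (real D / real (d + D)) ^ (2 * k)"
    by (intro power_mono) auto
  then show "exp (- (2 * (real k * real d / real D))) \<le> (real D / real (d + D)) ^ (2 * k)"
    by (simp add: exp_of_nat_mult[symmetric] mult_ac)
  have "real D / real (d + D) = 1 + - (real d / real (d + D))"
    using assms by (simp add: field_simps)
  also have "\<dots> \<le> exp (- (real d / real (d + D)))" by (rule exp_ge_add_one_self)
  finally have "(real D / real (d + D)) ^ (2 * k) \<le> exp (- (real d / real (d + D))) ^ (2 * k)"
    by (intro power_mono) auto
  then show "(real D / real (d + D)) ^ (2 * k) \<le> exp (- (2 * (real k * real d / real (d + D))))"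
    by (simp add: exp_of_nat_mult[symmetric] mult_ac)
qed

section \<open>The limit\<close>

lemma tendsto_floor_mult_sqrt:
  "(\<lambda>n. real_of_int \<lfloor>c * sqrt (real n)\<rfloor> / sqrt (real n)) \<longlonglongrightarrow> c"
proof (rule real_tendsto_sandwich)
  show "\<forall>\<^sub>F n in sequentially. c - 1 / sqrt (real n) \<le> real_of_int \<lfloor>c * sqrt (real n)\<rfloor> / sqrt (real n)"
  proof (rule eventually_mono[OF eventually_gt_at_top[of 0]])
    fix n :: nat
    assume "n > 0"
    then have "c - 1 / sqrt (real n) = (c * sqrt (real n) - 1) / sqrt (real n)"
      by (simp add: diff_divide_distrib)
    also have "\<dots> \<le> real_of_int \<lfloor>c * sqrt (real n)\<rfloor> / sqrt (real n)"
      using real_of_int_floor_gt_diff_one[of "c * sqrt (real n)"] \<open>n > 0\<close>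
      by (intro divide_right_mono less_imp_le) simp_all
    finally show "c - 1 / sqrt (real n) \<le> real_of_int \<lfloor>c * sqrt (real n)\<rfloor> / sqrt (real n)" .
  qed
  show "\<forall>\<^sub>F n in sequentially. real_of_int \<lfloor>c * sqrt (real n)\<rfloor> / sqrt (real n) \<le> c"
  proof (rule eventually_mono[OF eventually_gt_at_top[of 0]])
    fix n :: nat
    assume "n > 0"
    then show "real_of_int \<lfloor>c * sqrt (real n)\<rfloor> / sqrt (real n) \<le> c"
      by (simp add: field_simps)
  qed
  show "(\<lambda>n. c - 1 / sqrt (real n)) \<longlonglongrightarrow> c" by real_asymp
qed simp

text \<open>If \<open>k\<close> and \<open>d\<close> are of order \<open>sqrt n\<close>, then \<open>k\<^sup>2 / D\<close> stays bounded and \<open>k\<close> tends to infinity, so the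
  error bound of \<open>abs_S_minus_power_le\<close> tends to \<open>0\<close>.\<close>

lemma S_tendsto:
  fixes k d D :: "nat \<Rightarrow> nat"
  assumes k: "(\<lambda>n. real (k n) / sqrt n) \<longlonglongrightarrow> x" and d: "(\<lambda>n. real (d n) / sqrt n) \<longlonglongrightarrow> a"
    and pos: "x > 0" "a > 0" and n: "\<forall>\<^sub>F n in sequentially. d n + D n = n"
  shows "(\<lambda>n. S n (D n + k n) (k n) / real n ^ (D n + k n)) \<longlonglongrightarrow> exp (- (2 * (x * a)))"
proof -
  have sqrt: "filterlim (\<lambda>n. sqrt (real n)) at_top sequentially" by real_asymp
  have grow: "filterlim f at_top sequentially"
    if "(\<lambda>n. real (f n) / sqrt n) \<longlonglongrightarrow> c" "c > 0" for f :: "nat \<Rightarrow> nat" and c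
  proof -
    have "filterlim (\<lambda>n. real (f n) / sqrt n * sqrt n) at_top sequentially"
      using that sqrt by (rule filterlim_tendsto_pos_mult_at_top)
    moreover have "\<forall>\<^sub>F n in sequentially. real (f n) / sqrt n * sqrt n = real (f n)"
      by (rule eventually_mono[OF eventually_gt_at_top[of 0]]) simp
    ultimately have "filterlim (\<lambda>n. real (f n)) at_top sequentially"
      by (simp cong: filterlim_cong)
    then show ?thesis by (simp add: filterlim_sequentially_iff_filterlim_real)
  qed
  have inv_sqrt: "(\<lambda>n. 1 / sqrt (real n)) \<longlonglongrightarrow> 0" by real_asymp
  have D: "(\<lambda>n. real (D n) / n) \<longlonglongrightarrow> 1"
  proof -
    have "(\<lambda>n. 1 - real (d n) / sqrt n * (1 / sqrt n)) \<longlonglongrightarrow> 1 - a * 0"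
      by (intro tendsto_intros d inv_sqrt)
    then have "(\<lambda>n. 1 - real (d n) / sqrt n * (1 / sqrt n)) \<longlonglongrightarrow> 1"
      by simp
    moreover have "\<forall>\<^sub>F n in sequentially. 1 - real (d n) / sqrt n * (1 / sqrt n) = real (D n) / n"
      using n eventually_gt_at_top[of 0]
    proof eventually_elim
      case (elim n)
      then have "real n = real (d n) + real (D n)" by linarith
      with elim(2) show ?case by (simp add: field_simps)
    qed
    ultimately show ?thesis by (rule Lim_transform_eventually)
  qed
  have kd: "(\<lambda>n. real (k n) * real (d n) / n) \<longlonglongrightarrow> x * a"
  proof -
    have "real (k n) * real (d n) / n = real (k n) / sqrt n * (real (d n) / sqrt n)" for n
      by simp
    then show ?thesis using tendsto_mult[OF k d] by simp
  qed
  have k2: "(\<lambda>n. real (k n) ^ 2 / n) \<longlonglongrightarrow> x ^ 2"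
    using tendsto_power[OF k, of 2] by (simp add: power_divide)
  have over_D: "(\<lambda>n. f n / D n) \<longlonglongrightarrow> c" if "(\<lambda>n. f n / n) \<longlonglongrightarrow> c" for f :: "nat \<Rightarrow> real" and c
  proof -
    have "(\<lambda>n. (f n / n) / (real (D n) / n)) \<longlonglongrightarrow> c / 1"
      by (intro tendsto_divide that D) simp
    then have "(\<lambda>n. (f n / n) / (real (D n) / n)) \<longlonglongrightarrow> c"
      by simp
    moreover have "\<forall>\<^sub>F n in sequentially. (f n / n) / (real (D n) / n) = f n / D n"
      by (rule eventually_mono[OF eventually_gt_at_top[of 0]]) simp
    ultimately show ?thesis by (rule Lim_transform_eventually)
  qed
  have "\<forall>\<^sub>F n in sequentially. real (k n) / sqrt n * (1 / sqrt n) < real (D n) / n"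
  proof (rule eventually_mono[OF eventually_conj])
    have "(\<lambda>n. real (k n) / sqrt n * (1 / sqrt n)) \<longlonglongrightarrow> x * 0"
      by (intro tendsto_mult k inv_sqrt)
    then show "\<forall>\<^sub>F n in sequentially. real (k n) / sqrt n * (1 / sqrt n) < 1 / 2"
      by (rule order_tendstoD(2)) simp
    show "\<forall>\<^sub>F n in sequentially. 1 / 2 < real (D n) / n"
      using D by (rule order_tendstoD(1)) simp
  qed (elim conjE, rule less_trans)
  then have k_le_D: "\<forall>\<^sub>F n in sequentially. k n \<le> D n"
    using eventually_gt_at_top[of 0]
    by eventually_elim (simp add: field_simps)
  have k_ge: "\<forall>\<^sub>F n in sequentially. 2 \<le> k n"
    using grow[OF k pos(1)] by (simp add: filterlim_at_top)
  have d_pos: "\<forall>\<^sub>F n in sequentially. 1 \<le> d n"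
    using grow[OF d pos(2)] by (simp add: filterlim_at_top)
  have main: "(\<lambda>n. (real (D n) / n) ^ (2 * k n)) \<longlonglongrightarrow> exp (- (2 * (x * a)))"
  proof (rule real_tendsto_sandwich)
    show "\<forall>\<^sub>F n in sequentially. exp (- (2 * (real (k n) * d n / D n))) \<le> (real (D n) / n) ^ (2 * k n)"
      using n k_le_D k_ge
    proof eventually_elim
      case (elim n)
      then show ?case using power_bounds_exp(1)[of "D n" "k n" "d n"] by simp
    qed
    show "\<forall>\<^sub>F n in sequentially. (real (D n) / n) ^ (2 * k n) \<le> exp (- (2 * (real (k n) * d n / n)))"
      using n k_le_D k_ge
    proof eventually_elim
      case (elim n)
      then show ?case using power_bounds_exp(2)[of "D n" "d n" "k n"] by simp
    qed
    show "(\<lambda>n. exp (- (2 * (real (k n) * d n / D n)))) \<longlonglongrightarrow> exp (- (2 * (x * a)))"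
      by (intro tendsto_intros over_D kd)
    show "(\<lambda>n. exp (- (2 * (real (k n) * d n / n)))) \<longlonglongrightarrow> exp (- (2 * (x * a)))"
      by (intro tendsto_intros kd)
  qed
  have error: "(\<lambda>n. 2 * exp (real (k n) ^ 2 / D n) * (2 * (sqrt (k n) + 1) / (real (k n) - 1)))
      \<longlonglongrightarrow> 2 * exp (x ^ 2) * 0"
  proof (intro tendsto_intros over_D k2)
    have "(\<lambda>k. 2 * (sqrt (real k) + 1) / (real k - 1)) \<longlonglongrightarrow> 0" by real_asymp
    then show "(\<lambda>n. 2 * (sqrt (k n) + 1) / (real (k n) - 1)) \<longlonglongrightarrow> 0"
      using grow[OF k pos(1)] by (rule filterlim_compose)
  qed
  have "(\<lambda>n. S n (D n + k n) (k n) / real n ^ (D n + k n) - (real (D n) / n) ^ (2 * k n)) \<longlonglongrightarrow> 0"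
  proof (rule Lim_null_comparison)
    show "\<forall>\<^sub>F n in sequentially.
        norm (S n (D n + k n) (k n) / real n ^ (D n + k n) - (real (D n) / n) ^ (2 * k n))
        \<le> 2 * exp (real (k n) ^ 2 / D n) * (2 * (sqrt (k n) + 1) / (real (k n) - 1))"
      using n k_le_D k_ge d_pos
    proof eventually_elim
      case (elim n)
      then show ?case using abs_S_minus_power_le[of "d n" "k n" "D n"] by simp
    qed
  qed (use error in simp)
  from tendsto_add[OF this main] show ?thesis by simp
qed

text \<open>If \<open>x \<le> y\<close>, then \<open>\<lfloor>x * sqrt n\<rfloor> \<le> \<lfloor>y * sqrt n\<rfloor>\<close> for every \<open>n\<close>, so \<open>S\<close> is in its first branch.\<close>

lemma S_num_drivers_tendsto:
  fixes x y :: real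
  assumes "x > 0"
  shows "(\<lambda>n. S n (num_drivers y n) (nat \<lfloor>x * sqrt (real n)\<rfloor>) / real n ^ num_drivers y n)
           \<longlonglongrightarrow> (if x > y then exp (- 2 * x * (x - y)) else 1)"
proof (cases "x > y")
  case True
  define k where "k = (\<lambda>n. nat \<lfloor>x * sqrt (real n)\<rfloor>)"
  define d where "d = (\<lambda>n. nat (\<lfloor>x * sqrt (real n)\<rfloor> - \<lfloor>y * sqrt (real n)\<rfloor>))"
  define D where "D = (\<lambda>n. n - d n)"
  have int_k: "int (k n) = \<lfloor>x * sqrt (real n)\<rfloor>" for n
    using assms by (simp add: k_def)
  have int_d: "int (d n) = \<lfloor>x * sqrt (real n)\<rfloor> - \<lfloor>y * sqrt (real n)\<rfloor>" for n
    using True by (simp add: d_def floor_mono mult_right_mono)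
  have k: "(\<lambda>n. real (k n) / sqrt n) \<longlonglongrightarrow> x"
    using tendsto_floor_mult_sqrt[of x] by (simp add: int_k[symmetric])
  have d: "(\<lambda>n. real (d n) / sqrt n) \<longlonglongrightarrow> x - y"
  proof -
    have "real (d n) = real_of_int \<lfloor>x * sqrt (real n)\<rfloor> - real_of_int \<lfloor>y * sqrt (real n)\<rfloor>" for n
      using int_d[of n] by linarith
    then show ?thesis
      using tendsto_diff[OF tendsto_floor_mult_sqrt[of x] tendsto_floor_mult_sqrt[of y]]
      by (simp add: diff_divide_distrib)
  qed
  have "(\<lambda>n. real (d n) / sqrt n * (1 / sqrt n)) \<longlonglongrightarrow> (x - y) * 0"
    by (intro tendsto_mult d) real_asymp
  then have "\<forall>\<^sub>F n in sequentially. real (d n) / sqrt n * (1 / sqrt n) < 1"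
    by (rule order_tendstoD(2)) simp
  then have d_le: "\<forall>\<^sub>F n in sequentially. d n \<le> n"
    using eventually_gt_at_top[of 0] by eventually_elim (simp add: field_simps)
  have "(\<lambda>n. S n (D n + k n) (k n) / real n ^ (D n + k n)) \<longlonglongrightarrow> exp (- (2 * (x * (x - y))))"
    using True assms d_le by (intro S_tendsto[OF k d]) (auto simp: D_def elim: eventually_mono)
  moreover have "\<forall>\<^sub>F n in sequentially. D n + k n = num_drivers y n"
    using d_le
  proof eventually_elim
    case (elim n)
    then have "int n + \<lfloor>y * sqrt (real n)\<rfloor> = int (D n + k n)"
      using int_k[of n] int_d[of n] unfolding D_def by linarith
    then show ?case by (simp only: num_drivers_def nat_int)
  qed
  then have "\<forall>\<^sub>F n in sequentially. S n (D n + k n) (k n) / real n ^ (D n + k n)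
      = S n (num_drivers y n) (k n) / real n ^ num_drivers y n"
    by eventually_elim simp
  ultimately have "(\<lambda>n. S n (num_drivers y n) (k n) / real n ^ num_drivers y n)
      \<longlonglongrightarrow> exp (- (2 * (x * (x - y))))"
    by (rule Lim_transform_eventually)
  moreover have "- 2 * x * (x - y) = - (2 * (x * (x - y)))"
    by simp
  ultimately show ?thesis
    unfolding k_def using True by presburger
next
  case False
  have "S n (num_drivers y n) (nat \<lfloor>x * sqrt (real n)\<rfloor>) / real n ^ num_drivers y n = 1" if "n > 0" for n
  proof -
    have "\<lfloor>x * sqrt (real n)\<rfloor> \<le> \<lfloor>y * sqrt (real n)\<rfloor>"
      using False by (intro floor_mono mult_right_mono) auto
    moreover have "0 \<le> \<lfloor>x * sqrt (real n)\<rfloor>" using assms by simp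
    ultimately show ?thesis
      using that by (simp add: S_def num_drivers_def)
  qed
  then have "\<forall>\<^sub>F n in sequentially.
      S n (num_drivers y n) (nat \<lfloor>x * sqrt (real n)\<rfloor>) / real n ^ num_drivers y n = 1"
    by (rule eventually_mono[OF eventually_gt_at_top[of 0]])
  with False show ?thesis by (simp add: tendsto_eventually)
qed

theorem theorem8:
  fixes x y :: real
  assumes "x > 0"
  shows "(\<lambda>n. fail_prob n (num_drivers y n) (nat \<lfloor>x * sqrt (real n)\<rfloor>))
           \<longlonglongrightarrow> (if x > y then exp (- 2 * x * (x - y)) else 1)
       \<and> (\<lambda>n. S n (num_drivers y n) (nat \<lfloor>x * sqrt (real n)\<rfloor>) / real n ^ num_drivers y n)
           \<longlonglongrightarrow> (if x > y then exp (- 2 * x * (x - y)) else 1)"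
proof
  show S_limit: "(\<lambda>n. S n (num_drivers y n) (nat \<lfloor>x * sqrt (real n)\<rfloor>) / real n ^ num_drivers y n)
           \<longlonglongrightarrow> (if x > y then exp (- 2 * x * (x - y)) else 1)"
    by (rule S_num_drivers_tendsto[OF assms])
  have "\<forall>\<^sub>F n in sequentially. fail_prob n (num_drivers y n) (nat \<lfloor>x * sqrt (real n)\<rfloor>)
      = S n (num_drivers y n) (nat \<lfloor>x * sqrt (real n)\<rfloor>) / real n ^ num_drivers y n"
    by (rule eventually_mono[OF eventually_gt_at_top[of 0]]) (rule fail_prob_eq)
  from tendsto_cong[THEN iffD2, OF this S_limit]
  show "(\<lambda>n. fail_prob n (num_drivers y n) (nat \<lfloor>x * sqrt (real n)\<rfloor>))
           \<longlonglongrightarrow> (if x > y then exp (- 2 * x * (x - y)) else 1)" .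
qed

end
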